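(* Let $f:\mathbb{R}^n\to\mathbb{R}$ be a function with Lipschitz continuous gradient, i.e. there is a constant $L>0$ with $\|\nabla f(y_1)-\nabla f(y_2)\|\le L\|y_1-y_2\|$ for all $y_1,y_2\in\mathbb{R}^n$, and let $l\in\mathbb{R}$ be such that $f+\frac{l}{2}\|\cdot\|^2$ is convex. Let $g:\mathbb{R}^n\to(-\infty,\infty]$ be a proper closed function such that for every $x\in\mathbb{R}^n$ and $\gamma>0$ the set $\arg\min_{y}\{g(y)+\frac{1}{2\gamma}\|y-x\|^2\}$ is nonempty. Let $\alpha\in(\frac32,2]$ and let $\gamma>0$ satisfy $$\frac{4-\alpha}{2}(1+\gamma L)^2+\frac{9-2\alpha}{2}\gamma l-\frac{1+\alpha}{2}<0.$$ Suppose that both $f$ and $g$ are bounded from below, and that at least one of them is coercive. Then any sequence $\{(u^t,v^t,x^t)\}$ generated by the parameterized Douglas-Rachford iteration with parameters $\alpha,\gamma$ (from an arbitrary initial point $x^0\in\mathbb{R}^n$) is bounded.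
   Context: $\|\cdot\|$ is the Euclidean norm on $\mathbb{R}^n$. A function with values in $(-\infty,\infty]$ is proper if its domain (the set where it is finite) is nonempty, and closed if it is proper and lower semicontinuous. A function $h$ is coercive if $\liminf_{\|x\|\to\infty}h(x)=\infty$. Parameterized Douglas-Rachford iteration: given $x^0\in\mathbb{R}^n$, for $t=0,1,2,\dots$, $$u^{t+1}\in\arg\min_u\Big\{f(u)+\tfrac{1}{2\gamma}\|u-x^t\|^2\Big\},\quad v^{t+1}\in\arg\min_v\Big\{g(v)+\tfrac{1}{2\gamma}\|v-\alpha u^{t+1}+x^t\|^2\Big\},\quad x^{t+1}=x^t+(v^{t+1}-u^{t+1}).$$ *)

theory Defs
  imports "HOL-Analysis.Analysis"
begin

text \<open>Extended-real-valued functions are modelled as maps into \<open>ereal\<close>; \<open>proper_fun\<close> includes the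
  requirement that the value \<open>-\<infinity>\<close> is not attained.\<close>

definition proper_fun :: "('a \<Rightarrow> ereal) \<Rightarrow> bool" where
  "proper_fun h \<longleftrightarrow> (\<forall>x. h x \<noteq> -\<infinity>) \<and> (\<exists>x. h x \<noteq> \<infinity>)"

text \<open>\<open>Liminf (at x) h\<close> is taken over the punctured neighbourhoods of \<open>x\<close>.\<close>

definition lower_semicontinuous :: "('a::topological_space \<Rightarrow> ereal) \<Rightarrow> bool" where
  "lower_semicontinuous h \<longleftrightarrow> (\<forall>x. h x \<le> Liminf (at x) h)"

definition closed_fun :: "('a::topological_space \<Rightarrow> ereal) \<Rightarrow> bool" where
  "closed_fun h \<longleftrightarrow> proper_fun h \<and> lower_semicontinuous h"

definition coercive :: "('a::real_normed_vector \<Rightarrow> ereal) \<Rightarrow> bool" where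
  "coercive h \<longleftrightarrow> Liminf at_infinity h = \<infinity>"

text \<open>The bound is a real number: in the order of \<open>ereal\<close>, \<open>bdd_below\<close> would be vacuous.\<close>

definition bounded_from_below :: "('a \<Rightarrow> ereal) \<Rightarrow> bool" where
  "bounded_from_below h \<longleftrightarrow> (\<exists>m::real. \<forall>x. ereal m \<le> h x)"

definition argmin_set :: "('a \<Rightarrow> 'b::linorder) \<Rightarrow> 'a set" where
  "argmin_set h = {y. is_arg_min h (\<lambda>_. True) y}"

text \<open>The iteration does not produce \<open>u 0\<close> and \<open>v 0\<close>; they are left unconstrained.\<close>

definition param_DR_iteration ::
  "('a::real_normed_vector \<Rightarrow> real) \<Rightarrow> ('a \<Rightarrow> ereal) \<Rightarrow> real \<Rightarrow> real \<Rightarrow>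
   (nat \<Rightarrow> 'a) \<Rightarrow> (nat \<Rightarrow> 'a) \<Rightarrow> (nat \<Rightarrow> 'a) \<Rightarrow> bool" where
  "param_DR_iteration f g \<alpha> \<gamma> u v x \<longleftrightarrow>
     (\<forall>t. u (Suc t) \<in> argmin_set (\<lambda>w. f w + 1 / (2 * \<gamma>) * (norm (w - x t))\<^sup>2) \<and>
          v (Suc t) \<in> argmin_set
            (\<lambda>w. g w + ereal (1 / (2 * \<gamma>) * (norm (w - \<alpha> *\<^sub>R u (Suc t) + x t))\<^sup>2)) \<and>
          x (Suc t) = x t + (v (Suc t) - u (Suc t)))"

end

theory Submission
  imports Defs
begin

text \<open>The proof rests on the merit function
  \<open>\<gamma> (f u + g v) + \<parallel>v\<parallel>\<^sup>2 / 2 - \<alpha> \<langle>u, v\<rangle> + \<langle>x, v - u\<rangle> - \<parallel>u - v\<parallel>\<^sup>2 + (1 + \<alpha>) / 2 \<parallel>u\<parallel>\<^sup>2\<close>,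
  which equals \<open>\<gamma> (f u + g v) + (2 - \<alpha>) / 2 \<parallel>v\<parallel>\<^sup>2 - (3 - \<alpha>) / 2 \<parallel>v - u\<parallel>\<^sup>2 + \<langle>x - u, v - u\<rangle>\<close>.
  Along the iteration \<open>v\<^sup>t - u\<^sup>t = x\<^sup>t - x\<^sup>t\<^sup>-\<^sup>1\<close> is controlled by \<open>u\<^sup>t\<^sup>+\<^sup>1 - u\<^sup>t\<close> through the optimality
  condition \<open>x\<^sup>t = u\<^sup>t\<^sup>+\<^sup>1 + \<gamma> \<nabla>f(u\<^sup>t\<^sup>+\<^sup>1)\<close>, and the condition on \<open>\<gamma>\<close> makes the merit function
  nonincreasing. By the descent lemma for \<open>f\<close> it is bounded below by
  \<open>\<gamma> (f v + g v) + (\<alpha> - 1 - \<gamma> L) / 2 \<parallel>v - u\<parallel>\<^sup>2\<close> with a positive coefficient, so \<open>f v\<^sup>t + g v\<^sup>t\<close> and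
  \<open>v\<^sup>t - u\<^sup>t\<close> stay bounded, and coercivity bounds \<open>v\<^sup>t\<close>.\<close>

section \<open>Tangent and descent inequalities\<close>

text \<open>Restriction to the line through \<open>y\<close> and \<open>z\<close> reduces this to
  the one-dimensional tangent inequality.\<close>

lemma convex_above_tangent_gderiv:
  fixes h :: "'a::real_inner \<Rightarrow> real"
  assumes "convex_on UNIV h" and "GDERIV h y :> D"
  shows "h y + D \<bullet> (z - y) \<le> h z"
proof -
  define p where "p s = h (y + s *\<^sub>R (z - y))" for s :: real
  have "convex_on UNIV p"
  proof (rule convex_onI)
    fix t a b :: real
    assume "0 < t" "t < 1"
    moreover have "y + ((1 - t) * a + t * b) *\<^sub>R (z - y)
        = (1 - t) *\<^sub>R (y + a *\<^sub>R (z - y)) + t *\<^sub>R (y + b *\<^sub>R (z - y))"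
      by (simp add: algebra_simps)
    ultimately show "p ((1 - t) *\<^sub>R a + t *\<^sub>R b) \<le> (1 - t) * p a + t * p b"
      using convex_onD[OF assms(1), of t "y + a *\<^sub>R (z - y)" "y + b *\<^sub>R (z - y)"]
      by (simp add: p_def)
  qed simp
  moreover have "(p has_real_derivative D \<bullet> (z - y)) (at 0)"
  proof -
    have "(h has_derivative (\<lambda>w. w \<bullet> D)) (at (y + 0 *\<^sub>R (z - y)))"
      using assms(2) by (simp add: gderiv_def)
    moreover have "((\<lambda>s. y + s *\<^sub>R (z - y)) has_derivative (\<lambda>s. s *\<^sub>R (z - y))) (at 0)"
      by (auto intro!: derivative_eq_intros)
    ultimately have "(p has_derivative (\<lambda>s. (s *\<^sub>R (z - y)) \<bullet> D)) (at 0)"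
      unfolding p_def by (rule has_derivative_compose[rotated])
    then show ?thesis
      by (simp add: has_field_derivative_def inner_commute mult_commute_abs)
  qed
  ultimately have "p 1 - p 0 \<ge> (D \<bullet> (z - y)) * (1 - 0)"
    by (intro convex_on_imp_above_tangent[of UNIV]) auto
  then show ?thesis by (simp add: p_def)
qed

text \<open>The convexified function has gradient \<open>D + l *\<^sub>R y\<close> at
  \<open>y\<close>. Expanding the squares in its tangent inequality leaves exactly the quadratic
  defect.\<close>

lemma weakly_convex_above_tangent:
  fixes f :: "'a::real_inner \<Rightarrow> real"
  assumes "convex_on UNIV (\<lambda>y. f y + l / 2 * (norm y)\<^sup>2)" and "GDERIV f y :> D"
  shows "f y + D \<bullet> (z - y) - l / 2 * (norm (z - y))\<^sup>2 \<le> f z"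
proof -
  have "GDERIV (\<lambda>w. f w + l / 2 * (norm w)\<^sup>2) y :> D + l *\<^sub>R y"
    using assms(2) unfolding gderiv_def power2_norm_eq_inner
    by (auto intro!: derivative_eq_intros simp: algebra_simps inner_commute)
  from convex_above_tangent_gderiv[OF assms(1) this, of z]
  show ?thesis
    by (simp add: power2_norm_eq_inner algebra_simps inner_commute)
qed

text \<open>Sum of the tangent inequalities at \<open>y\<close> and at \<open>z\<close>.\<close>

lemma weakly_convex_gradient_lower_bound:
  fixes f :: "'a::real_inner \<Rightarrow> real"
  assumes "convex_on UNIV (\<lambda>y. f y + l / 2 * (norm y)\<^sup>2)" and "\<And>y. GDERIV f y :> df y"
  shows "- l * (norm (y - z))\<^sup>2 \<le> (df y - df z) \<bullet> (y - z)"
  using weakly_convex_above_tangent[OF assms(1) assms(2)[of y], of z]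
    weakly_convex_above_tangent[OF assms(1) assms(2)[of z], of y]
  by (simp add: power2_norm_eq_inner algebra_simps inner_commute)

lemma lipschitz_gradient_upper_bound:
  fixes df :: "'a::real_inner \<Rightarrow> 'a"
  assumes "norm (df y - df z) \<le> L * norm (y - z)"
  shows "(df y - df z) \<bullet> (y - z) \<le> L * (norm (y - z))\<^sup>2"
proof -
  have "(df y - df z) \<bullet> (y - z) \<le> norm (df y - df z) * norm (y - z)"
    by (rule norm_cauchy_schwarz)
  also have "\<dots> \<le> (L * norm (y - z)) * norm (y - z)"
    using assms by (rule mult_right_mono) simp
  finally show ?thesis by (simp add: power2_eq_square)
qed

lemma descent_lemma:
  fixes f :: "'a::real_inner \<Rightarrow> real"
  assumes grad: "\<And>y. GDERIV f y :> df y"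
    and lip: "\<And>y z. norm (df y - df z) \<le> L * norm (y - z)"
  shows "f z \<le> f y + df y \<bullet> (z - y) + L / 2 * (norm (z - y))\<^sup>2"
proof -
  define d where "d = z - y"
  \<comment> \<open>Up to the constant \<open>f y\<close>, this is \<open>f\<close> minus its
    quadratic upper model along the segment; the Lipschitz bound makes its derivative nonpositive on
    [0, 1].\<close>
  define p where "p s = f (y + s *\<^sub>R d) - s * (df y \<bullet> d) - L / 2 * s\<^sup>2 * (norm d)\<^sup>2" for s :: real
  have deriv: "(p has_real_derivative (df (y + s *\<^sub>R d) - df y) \<bullet> d - L * s * (norm d)\<^sup>2) (at s)" for s
  proof -
    have "(f has_derivative (\<lambda>w. w \<bullet> df (y + s *\<^sub>R d))) (at (y + s *\<^sub>R d))"
      using grad by (simp add: gderiv_def)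
    moreover have "((\<lambda>s. y + s *\<^sub>R d) has_derivative (\<lambda>s. s *\<^sub>R d)) (at s)"
      by (auto intro!: derivative_eq_intros)
    ultimately have "((\<lambda>s. f (y + s *\<^sub>R d)) has_derivative (\<lambda>r. (r *\<^sub>R d) \<bullet> df (y + s *\<^sub>R d))) (at s)"
      by (rule has_derivative_compose[rotated])
    then have "((\<lambda>s. f (y + s *\<^sub>R d)) has_real_derivative df (y + s *\<^sub>R d) \<bullet> d) (at s)"
      by (simp add: has_field_derivative_def inner_commute mult_commute_abs)
    then show ?thesis
      unfolding p_def
      by (auto intro!: derivative_eq_intros simp: algebra_simps)
  qed
  have "p 1 \<le> p 0"
  proof (rule DERIV_nonpos_imp_nonincreasing[of 0 1 p])
    fix s :: real
    assume "0 \<le> s" "s \<le> 1"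
    have "(df (y + s *\<^sub>R d) - df y) \<bullet> d \<le> norm (df (y + s *\<^sub>R d) - df y) * norm d"
      by (rule norm_cauchy_schwarz)
    also have "\<dots> \<le> (L * norm (s *\<^sub>R d)) * norm d"
      using lip[of "y + s *\<^sub>R d" y] by (intro mult_right_mono) auto
    also have "\<dots> = L * s * (norm d)\<^sup>2"
      using \<open>0 \<le> s\<close> by (simp add: power2_eq_square)
    finally show "\<exists>D. (p has_real_derivative D) (at s) \<and> D \<le> 0"
      using deriv[of s] by auto
  qed simp
  then show ?thesis by (simp add: p_def d_def)
qed

section \<open>First-order optimality and coercivity\<close>

text \<open>Fermat's rule: the gradient \<open>E\<close> of the proximal objective vanishes at a
  minimizer.\<close>

lemma prox_gradient_optimality:
  fixes f :: "'a::real_inner \<Rightarrow> real"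
  assumes "w \<in> argmin_set (\<lambda>y. f y + 1 / (2 * \<gamma>) * (norm (y - x))\<^sup>2)"
    and grad: "GDERIV f w :> D" and "\<gamma> > 0"
  shows "x = w + \<gamma> *\<^sub>R D"
proof -
  define h where "h y = f y + 1 / (2 * \<gamma>) * (norm (y - x))\<^sup>2" for y
  define E where "E = D + (1 / \<gamma>) *\<^sub>R (w - x)"
  have "h w \<le> h y" for y
    using assms(1) by (auto simp: argmin_set_def is_arg_min_def h_def not_less)
  moreover have "(h has_derivative (\<lambda>k. k \<bullet> E)) (at w)"
    using grad \<open>\<gamma> > 0\<close> unfolding gderiv_def h_def E_def power2_norm_eq_inner
    by (auto intro!: derivative_eq_intros simp: field_simps inner_commute inner_add_right inner_diff_right)
  ultimately have "(\<lambda>k. k \<bullet> E) = (\<lambda>k. 0)"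
    by (intro has_derivative_local_min[of h _ w]) auto
  then have "E \<bullet> E = 0" by meson
  then have "\<gamma> *\<^sub>R E = 0" by simp
  then show ?thesis
    using \<open>\<gamma> > 0\<close> by (simp add: E_def algebra_simps)
qed

lemma coercive_sublevel_bounded:
  fixes h :: "'a::real_normed_vector \<Rightarrow> ereal"
  assumes "coercive h"
  shows "bounded {y. h y \<le> ereal C}"
proof -
  have "ereal C < Liminf at_infinity h"
    using assms by (simp add: coercive_def)
  from less_LiminfD[OF this] obtain b where b: "\<And>y. b \<le> norm y \<Longrightarrow> ereal C < h y"
    by (auto simp: eventually_at_infinity)
  show ?thesis
    unfolding bounded_iff using b by (metis leD le_cases mem_Collect_eq)
qed

section \<open>Estimates for the merit function\<close>

text \<open>The reals \<open>a\<close> and \<open>b\<close> stand for the values of \<open>f\<close>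
  at \<open>u\<close> and of \<open>g\<close> at \<open>v\<close>, which keeps the algebra out of
  \<open>ereal\<close>.\<close>

definition DR_merit :: "real \<Rightarrow> real \<Rightarrow> 'a::real_inner \<Rightarrow> 'a \<Rightarrow> 'a \<Rightarrow> real \<Rightarrow> real \<Rightarrow> real" where
  "DR_merit \<alpha> \<gamma> u v x a b = \<gamma> * (a + b) + (norm v)\<^sup>2 / 2 - \<alpha> * (u \<bullet> v) + x \<bullet> (v - u)
     - (norm (u - v))\<^sup>2 + (1 + \<alpha>) / 2 * (norm u)\<^sup>2"

text \<open>The premises are the tangent inequality for \<open>f\<close> at \<open>u'\<close> and
  the minimality of \<open>v'\<close> tested against \<open>v\<close>, both scaled by \<gamma>.
  Updating \<open>x\<close> adds \<open>(norm (v' - u'))\<^sup>2\<close> to the inner product, which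
  the negative square in the merit function cancels; adding the premises then gives the
  claim.\<close>

lemma DR_merit_step:
  fixes u u' v v' x :: "'a::real_inner"
  assumes "\<gamma> * a' + (x - u') \<bullet> (u - u') - \<gamma> * l / 2 * (norm (u - u'))\<^sup>2 \<le> \<gamma> * a"
    and "\<gamma> * b' + (norm (v' - \<alpha> *\<^sub>R u' + x))\<^sup>2 / 2 \<le> \<gamma> * b + (norm (v - \<alpha> *\<^sub>R u' + x))\<^sup>2 / 2"
  shows "DR_merit \<alpha> \<gamma> u' v' (x + (v' - u')) a' b' \<le> DR_merit \<alpha> \<gamma> u v x a b
     + ((\<alpha> - (1 - \<gamma> * l)) / 2 * (norm (u' - u))\<^sup>2 - \<alpha> * ((v - u) \<bullet> (u' - u)) + (norm (v - u))\<^sup>2)"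
  using assms unfolding DR_merit_def power2_norm_eq_inner
  by (simp add: algebra_simps inner_commute add_divide_distrib diff_divide_distrib)

text \<open>Here \<open>c\<close> plays the role of \<open>f v\<close>. Substituting
  \<open>x\<close> turns the inner product into the linear term of the descent lemma plus a full
  square of \<open>v - u\<close>.\<close>

lemma DR_merit_lower_bound:
  fixes u v x :: "'a::real_inner"
  assumes "c \<le> a + D \<bullet> (v - u) + L / 2 * (norm (v - u))\<^sup>2"
    and "x = v + \<gamma> *\<^sub>R D" and "\<alpha> \<le> 2" and "\<gamma> > 0"
  shows "\<gamma> * (c + b) + ((\<alpha> - 1) - \<gamma> * L) / 2 * (norm (v - u))\<^sup>2 \<le> DR_merit \<alpha> \<gamma> u v x a b"
proof -
  have "DR_merit \<alpha> \<gamma> u v x a b = \<gamma> * (a + D \<bullet> (v - u) + b) + (2 - \<alpha>) / 2 * (norm v)\<^sup>2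
     + (\<alpha> - 1) / 2 * (norm (v - u))\<^sup>2"
    unfolding DR_merit_def assms(2) power2_norm_eq_inner
    by (simp add: algebra_simps inner_commute add_divide_distrib diff_divide_distrib)
  moreover have "(2 - \<alpha>) / 2 * (norm v)\<^sup>2 \<ge> 0"
    using \<open>\<alpha> \<le> 2\<close> by simp
  moreover have "\<gamma> * c \<le> \<gamma> * (a + D \<bullet> (v - u) + L / 2 * (norm (v - u))\<^sup>2)"
    using assms by simp
  ultimately show ?thesis by (simp add: algebra_simps add_divide_distrib diff_divide_distrib)
qed

text \<open>The first conclusion is the decrease of the merit function. It follows from the step size
  condition because \<open>(1 + \<gamma> L)\<^sup>2 + 4 \<gamma> l \<ge> (1 - \<gamma> L)\<^sup>2\<close>. Together with \<open>\<gamma> l \<ge> - \<gamma> L\<close> it gives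
  \<open>(\<gamma> L - (\<alpha> - 1)) (\<gamma> L + 1/2) < 0\<close>, hence the second.\<close>

lemma stepsize_consequences:
  fixes \<alpha> \<gamma> l L :: real
  assumes "\<alpha> \<le> 2" and "\<gamma> > 0" and "L > 0" and "- l \<le> L"
    and cond: "(4 - \<alpha>) / 2 * (1 + \<gamma> * L)\<^sup>2 + (9 - 2 * \<alpha>) / 2 * \<gamma> * l - (1 + \<alpha>) / 2 < 0"
  shows "(1 + \<gamma> * L)\<^sup>2 + (1 / 2 + \<alpha>) * (\<gamma> * l) - (1 + \<alpha>) / 2 < 0"
    and "\<alpha> \<ge> - 1 / 2 \<Longrightarrow> \<gamma> * L < \<alpha> - 1"
proof -
  define s where "s = \<gamma> * L"
  define m where "m = \<gamma> * l"
  have "s > 0" using assms by (simp add: s_def)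
  have "- m \<le> s"
    using assms mult_left_mono[of "- l" L \<gamma>] by (simp add: s_def m_def)
  have "(1 + s)\<^sup>2 + 4 * m \<ge> (1 - s)\<^sup>2"
    using \<open>- m \<le> s\<close> by (simp add: power2_eq_square algebra_simps)
  then have "(1 + s)\<^sup>2 + 4 * m \<ge> 0"
    using zero_le_power2[of "1 - s"] by linarith
  \<comment> \<open>This is exactly the difference between the left-hand sides of
    \<open>cond\<close> and of the claim.\<close>
  then have "(2 - \<alpha>) / 2 * ((1 + s)\<^sup>2 + 4 * m) \<ge> 0"
    using \<open>\<alpha> \<le> 2\<close> by simp
  then have 1: "(1 + s)\<^sup>2 + (1 / 2 + \<alpha>) * m - (1 + \<alpha>) / 2 < 0"
    using cond[folded s_def] by (simp add: m_def field_simps)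
  then show "(1 + \<gamma> * L)\<^sup>2 + (1 / 2 + \<alpha>) * (\<gamma> * l) - (1 + \<alpha>) / 2 < 0"
    by (simp add: s_def m_def)
  assume "\<alpha> \<ge> - 1 / 2"
  then have "(1 / 2 + \<alpha>) * (- m) \<le> (1 / 2 + \<alpha>) * s"
    using \<open>- m \<le> s\<close> by (intro mult_left_mono) auto
  with 1 have "(1 + s)\<^sup>2 - (1 / 2 + \<alpha>) * s - (1 + \<alpha>) / 2 < 0"
    by simp
  moreover have "(1 + s)\<^sup>2 - (1 / 2 + \<alpha>) * s - (1 + \<alpha>) / 2 = (s - (\<alpha> - 1)) * (s + 1 / 2)"
    by (simp add: power2_eq_square field_simps)
  ultimately have "(s - (\<alpha> - 1)) * (s + 1 / 2) < 0"
    by linarith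
  then show "\<gamma> * L < \<alpha> - 1"
    using \<open>s > 0\<close> by (simp add: mult_less_0_iff flip: s_def)
qed

theorem theorem3p6:
  fixes f :: "real ^ 'n \<Rightarrow> real" and gradf :: "real ^ 'n \<Rightarrow> real ^ 'n"
    and g :: "real ^ 'n \<Rightarrow> ereal"
    and L l \<alpha> \<gamma> :: real
    and u v x :: "nat \<Rightarrow> real ^ 'n"
  assumes gradient: "\<And>y. GDERIV f y :> gradf y"
    and L_pos: "L > 0"
    and gradient_lipschitz: "\<And>y1 y2. norm (gradf y1 - gradf y2) \<le> L * norm (y1 - y2)"
    and weakly_convex: "convex_on UNIV (\<lambda>y. f y + l / 2 * (norm y)\<^sup>2)"
    and g_closed: "closed_fun g"
    and g_prox: "\<And>y \<delta>. \<delta> > 0 \<Longrightarrow>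
      argmin_set (\<lambda>w. g w + ereal (1 / (2 * \<delta>) * (norm (w - y))\<^sup>2)) \<noteq> {}"
    and \<alpha>_range: "3 / 2 < \<alpha>" "\<alpha> \<le> 2"
    and \<gamma>_pos: "\<gamma> > 0"
    and \<gamma>_cond: "(4 - \<alpha>) / 2 * (1 + \<gamma> * L)\<^sup>2 + (9 - 2 * \<alpha>) / 2 * \<gamma> * l - (1 + \<alpha>) / 2 < 0"
    and f_below: "bounded_from_below (\<lambda>y. ereal (f y))"
    and g_below: "bounded_from_below g"
    and one_coercive: "coercive (\<lambda>y. ereal (f y)) \<or> coercive g"
    and iteration: "param_DR_iteration f g \<alpha> \<gamma> u v x"
  shows "bounded (range (\<lambda>t. (u t, v t, x t)))"
proof -
  have above: "\<And>y z. f y + gradf y \<bullet> (z - y) - l / 2 * (norm (z - y))\<^sup>2 \<le> f z"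
    using weakly_convex_above_tangent[OF weakly_convex gradient] .
  have "- l \<le> L"
  proof -
    \<comment> \<open>A nonzero vector is needed to compare the two gradient bounds.\<close>
    obtain e :: "real ^ 'n" where "e \<in> Basis" using nonempty_Basis by blast
    then show ?thesis
      using weakly_convex_gradient_lower_bound[OF weakly_convex gradient, where y = e and z = 0]
        lipschitz_gradient_upper_bound[OF gradient_lipschitz[of e 0]]
      by simp
  qed
  note stepsize = stepsize_consequences[OF \<alpha>_range(2) \<gamma>_pos L_pos this \<gamma>_cond]
  have gap: "\<alpha> - 1 - \<gamma> * L > 0"
    using stepsize(2) \<alpha>_range by simp

  have g_not_MInf: "g y \<noteq> - \<infinity>" for y
    using g_closed by (simp add: closed_fun_def proper_fun_def)
  obtain y0 where y0: "g y0 \<noteq> \<infinity>"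
    using g_closed by (auto simp: closed_fun_def proper_fun_def)
  have v_min: "g (v (Suc t)) + ereal (1 / (2 * \<gamma>) * (norm (v (Suc t) - \<alpha> *\<^sub>R u (Suc t) + x t))\<^sup>2)
      \<le> g w + ereal (1 / (2 * \<gamma>) * (norm (w - \<alpha> *\<^sub>R u (Suc t) + x t))\<^sup>2)" for t w
    using iteration
    by (auto simp: param_DR_iteration_def argmin_set_def is_arg_min_def not_less)
  define b where "b t = real_of_ereal (g (v t))" for t
  \<comment> \<open>Finite by comparison with \<open>y0\<close>. Only successor indices qualify,
    since \<open>v 0\<close> is arbitrary.\<close>
  have gb: "g (v (Suc t)) = ereal (b (Suc t))" for t
    unfolding b_def using v_min[of t y0] y0 g_not_MInf[of "v (Suc t)"] g_not_MInf[of y0]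
    by (cases "g (v (Suc t))"; cases "g y0") auto
  have x_Suc: "x (Suc t) = x t + (v (Suc t) - u (Suc t))" for t
    using iteration by (simp add: param_DR_iteration_def)
  have x_opt: "x t = u (Suc t) + \<gamma> *\<^sub>R gradf (u (Suc t))" for t
    using iteration prox_gradient_optimality[OF _ gradient \<gamma>_pos]
    by (auto simp: param_DR_iteration_def)

  \<comment> \<open>The index is shifted by one because \<open>u 0\<close> and \<open>v 0\<close>
    are unconstrained.\<close>
  define M where "M t = DR_merit \<alpha> \<gamma> (u (Suc t)) (v (Suc t)) (x (Suc t)) (f (u (Suc t))) (b (Suc t))" for t
  have M_step: "M (Suc t) \<le> M t" for t
  proof -
    define u1 u2 v1 d where "u1 = u (Suc t)" and "u2 = u (Suc (Suc t))" and "v1 = v (Suc t)"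
      and "d = v1 - u1"
    have d: "d = (u2 - u1) + \<gamma> *\<^sub>R (gradf u2 - gradf u1)"
      using x_opt[of t] x_opt[of "Suc t"] x_Suc[of t]
      by (simp add: d_def u1_def u2_def v1_def algebra_simps)
    have "f u2 + gradf u2 \<bullet> (u1 - u2) - l / 2 * (norm (u1 - u2))\<^sup>2 \<le> f u1"
      by (rule above)
    then have "\<gamma> * (f u2 + gradf u2 \<bullet> (u1 - u2) - l / 2 * (norm (u1 - u2))\<^sup>2) \<le> \<gamma> * f u1"
      using \<gamma>_pos by simp
    moreover have "x (Suc t) - u2 = \<gamma> *\<^sub>R gradf u2"
      by (simp add: x_opt u2_def)
    ultimately have A: "\<gamma> * f u2 + (x (Suc t) - u2) \<bullet> (u1 - u2) - \<gamma> * l / 2 * (norm (u1 - u2))\<^sup>2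
        \<le> \<gamma> * f u1"
      by (simp add: algebra_simps)
    have B: "\<gamma> * b (Suc (Suc t)) + (norm (v (Suc (Suc t)) - \<alpha> *\<^sub>R u2 + x (Suc t)))\<^sup>2 / 2
        \<le> \<gamma> * b (Suc t) + (norm (v1 - \<alpha> *\<^sub>R u2 + x (Suc t)))\<^sup>2 / 2"
    proof -
      have scale: "\<gamma> * p + r / 2 \<le> \<gamma> * q + s / 2"
        if "p + 1 / (2 * \<gamma>) * r \<le> q + 1 / (2 * \<gamma>) * s" for p q r s
        using mult_left_mono[OF that, of \<gamma>] \<gamma>_pos by (simp add: distrib_left)
      show ?thesis
        using v_min[of "Suc t" v1] by (intro scale) (simp add: gb u2_def v1_def)
    qed
    have le: "M (Suc t) \<le> M t + ((\<alpha> - (1 - \<gamma> * l)) / 2 * (norm (u2 - u1))\<^sup>2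
        - \<alpha> * (d \<bullet> (u2 - u1)) + (norm d)\<^sup>2)"
      using DR_merit_step[OF A B] unfolding M_def x_Suc[of "Suc t"] d_def
      by (simp only: u1_def u2_def v1_def)
    \<comment> \<open>Weak convexity bounds the inner product from below and the Lipschitz condition
      bounds \<open>norm d\<close> from above; the resulting coefficient is the one in
      \<open>stepsize(1)\<close>.\<close>
    have "(1 - \<gamma> * l) * (norm (u2 - u1))\<^sup>2 \<le> d \<bullet> (u2 - u1)"
    proof -
      have "\<gamma> * (- l * (norm (u2 - u1))\<^sup>2) \<le> \<gamma> * ((gradf u2 - gradf u1) \<bullet> (u2 - u1))"
        using weakly_convex_gradient_lower_bound[OF weakly_convex gradient] \<gamma>_pos
        by (intro mult_left_mono) auto
      moreover have "d \<bullet> (u2 - u1) = (norm (u2 - u1))\<^sup>2 + \<gamma> * ((gradf u2 - gradf u1) \<bullet> (u2 - u1))"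
        by (simp add: d inner_add_left power2_norm_eq_inner)
      ultimately show ?thesis by (simp add: algebra_simps)
    qed
    then have "\<alpha> * ((1 - \<gamma> * l) * (norm (u2 - u1))\<^sup>2) \<le> \<alpha> * (d \<bullet> (u2 - u1))"
      using \<alpha>_range by (intro mult_left_mono) auto
    moreover have "(norm d)\<^sup>2 \<le> (1 + \<gamma> * L)\<^sup>2 * (norm (u2 - u1))\<^sup>2"
    proof -
      have "norm d \<le> norm (u2 - u1) + \<gamma> * norm (gradf u2 - gradf u1)"
        unfolding d using norm_triangle_ineq[of "u2 - u1" "\<gamma> *\<^sub>R (gradf u2 - gradf u1)"] \<gamma>_pos
        by simp
      also have "\<dots> \<le> norm (u2 - u1) + \<gamma> * (L * norm (u2 - u1))"
        using gradient_lipschitz \<gamma>_pos by simp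
      finally have "norm d \<le> (1 + \<gamma> * L) * norm (u2 - u1)"
        by (simp add: algebra_simps)
      from power_mono[OF this, of 2] show ?thesis by (simp add: power_mult_distrib)
    qed
    ultimately have "(\<alpha> - (1 - \<gamma> * l)) / 2 * (norm (u2 - u1))\<^sup>2 - \<alpha> * (d \<bullet> (u2 - u1)) + (norm d)\<^sup>2
        \<le> ((1 + \<gamma> * L)\<^sup>2 + (1 / 2 + \<alpha>) * (\<gamma> * l) - (1 + \<alpha>) / 2) * (norm (u2 - u1))\<^sup>2"
      by (simp add: algebra_simps add_divide_distrib diff_divide_distrib)
    also have "\<dots> \<le> 0"
      using stepsize(1) by (intro mult_nonpos_nonneg) auto
    finally show ?thesis using le by linarith
  qed
  have M_le: "M t \<le> M 0" for t
    using M_step by (rule lift_Suc_antimono_le) simp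

  have energy: "\<gamma> * (f (v (Suc t)) + b (Suc t))
      + (\<alpha> - 1 - \<gamma> * L) / 2 * (norm (v (Suc t) - u (Suc t)))\<^sup>2 \<le> M 0" for t
  proof -
    have "x (Suc t) = v (Suc t) + \<gamma> *\<^sub>R gradf (u (Suc t))"
      using x_Suc[of t] x_opt[of t] by simp
    from DR_merit_lower_bound[OF descent_lemma[OF gradient gradient_lipschitz] this \<alpha>_range(2) \<gamma>_pos]
    show ?thesis using M_le[of t] unfolding M_def by (meson order_trans)
  qed
  obtain mf where mf: "mf \<le> f y" for y
    using f_below by (auto simp: bounded_from_below_def)
  obtain mg where mg: "ereal mg \<le> g y" for y
    using g_below by (auto simp: bounded_from_below_def)
  have mb: "mg \<le> b (Suc t)" for t
    using mg[of "v (Suc t)"] by (simp add: gb)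
  have sum_le: "f (v (Suc t)) + b (Suc t) \<le> M 0 / \<gamma>" for t
  proof -
    have "(\<alpha> - 1 - \<gamma> * L) / 2 * (norm (v (Suc t) - u (Suc t)))\<^sup>2 \<ge> 0"
      using gap by simp
    then show ?thesis using energy[of t] \<gamma>_pos by (simp add: pos_le_divide_eq mult.commute)
  qed

  \<comment> \<open>Boundedness of the iterates\<close>
  have v_bdd: "bounded (range (\<lambda>t. v (Suc t)))"
    using one_coercive
  proof
    assume "coercive (\<lambda>y. ereal (f y))"
    \<comment> \<open>The lower bound on one summand of \<open>sum_le\<close> becomes an upper bound
      on the other, coercive one.\<close>
    from coercive_sublevel_bounded[OF this, of "M 0 / \<gamma> - mg"] show ?thesis
    proof (rule bounded_subset)
      show "range (\<lambda>t. v (Suc t)) \<subseteq> {y. ereal (f y) \<le> ereal (M 0 / \<gamma> - mg)}"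
        using sum_le mb by (auto simp: le_diff_eq intro: order_trans[OF add_left_mono])
    qed
  next
    assume "coercive g"
    from coercive_sublevel_bounded[OF this, of "M 0 / \<gamma> - mf"] show ?thesis
    proof (rule bounded_subset)
      have "b (Suc t) \<le> M 0 / \<gamma> - mf" for t
        using sum_le[of t] mf[of "v (Suc t)"] by linarith
      then show "range (\<lambda>t. v (Suc t)) \<subseteq> {y. g y \<le> ereal (M 0 / \<gamma> - mf)}"
        by (auto simp: gb)
    qed
  qed
  have d_bdd: "bounded (range (\<lambda>t. v (Suc t) - u (Suc t)))"
  proof -
    \<comment> \<open>Obtained by solving \<open>energy\<close> for the square after replacing
      \<open>f\<close> and \<open>b\<close> by their lower bounds.\<close>
    define K where "K = 2 * (M 0 - \<gamma> * (mf + mg)) / (\<alpha> - 1 - \<gamma> * L)"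
    have "norm (v (Suc t) - u (Suc t)) \<le> sqrt K" for t
    proof (rule real_le_rsqrt)
      have "\<gamma> * (mf + mg) \<le> \<gamma> * (f (v (Suc t)) + b (Suc t))"
        using mf mb \<gamma>_pos by (simp add: add_mono)
      then show "(norm (v (Suc t) - u (Suc t)))\<^sup>2 \<le> K"
        using energy[of t] gap unfolding K_def by (simp add: pos_le_divide_eq mult.commute)
    qed
    then show ?thesis by (auto simp: bounded_iff)
  qed
  have u_bdd: "bounded (range (\<lambda>t. u (Suc t)))"
    using bounded_minus_comp[OF v_bdd d_bdd] by simp
  \<comment> \<open>By \<open>x_opt\<close>, \<open>x t\<close> is a function of
    \<open>u (Suc t)\<close> of at most linear growth; this covers \<open>x 0\<close> too.\<close>
  have x_bdd: "bounded (range x)"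
  proof -
    obtain B where B: "norm (u (Suc t)) \<le> B" for t
      using u_bdd by (auto simp: bounded_iff)
    have "norm (x t) \<le> B + \<gamma> * (norm (gradf 0) + L * B)" for t
    proof -
      have "norm (gradf (u (Suc t))) \<le> norm (gradf 0) + norm (gradf (u (Suc t)) - gradf 0)"
        by (rule norm_triangle_sub)
      also have "\<dots> \<le> norm (gradf 0) + L * norm (u (Suc t))"
        using gradient_lipschitz[of "u (Suc t)" 0] by simp
      also have "\<dots> \<le> norm (gradf 0) + L * B"
        using B L_pos by simp
      finally have "\<gamma> * norm (gradf (u (Suc t))) \<le> \<gamma> * (norm (gradf 0) + L * B)"
        using \<gamma>_pos by simp
      moreover have "norm (x t) \<le> norm (u (Suc t)) + \<gamma> * norm (gradf (u (Suc t)))"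
        unfolding x_opt
        using norm_triangle_ineq[of "u (Suc t)" "\<gamma> *\<^sub>R gradf (u (Suc t))"] \<gamma>_pos by simp
      ultimately show ?thesis using B[of t] by linarith
    qed
    then show ?thesis by (auto simp: bounded_iff)
  qed

  \<comment> \<open>The arbitrary values \<open>u 0\<close> and \<open>v 0\<close> add only one
    point to each range.\<close>
  have range_Suc: "range w = insert (w 0) (range (\<lambda>t. w (Suc t)))" for w :: "nat \<Rightarrow> real ^ 'n"
    by (auto simp: image_iff) (metis not0_implies_Suc)
  have "bounded (range u)" "bounded (range v)"
    using u_bdd v_bdd by (simp_all add: range_Suc[of u] range_Suc[of v])
  with x_bdd have "bounded (range u \<times> range v \<times> range x)"
    by (intro bounded_Times)
  then show ?thesis by (rule bounded_subset) auto
qed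

end
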